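(* Let $p_3>0$, $p_1=3p_3$, $\rho>0$, and consider the system $$\mathcal{D}'=2\mathcal{I}(p_1\mathcal{D}-p_3\mathcal{R}),\qquad\mathcal{R}'=2\mathcal{I}(p_1\mathcal{R}-p_3\mathcal{D}),\qquad\mathcal{I}'=-2p_1(\mathcal{D}^2+\mathcal{R}^2)+4p_3\mathcal{D}\mathcal{R}$$ on $S^2_\rho$. There are two fixed points $\pm(0,0,\rho)$. If the initial point is not a fixed point, then, with $$\Gamma=\sqrt{8\rho^2(\mathcal{D}(0)-\mathcal{R}(0))^2+(\mathcal{D}(0)+\mathcal{R}(0))^4},\qquad W(\tau)=\Gamma\cosh(8p_3\rho\tau+\tau_0)+(\mathcal{D}(0)+\mathcal{R}(0))^2,$$ the solution is given by $$\mathcal{D}(\tau)=\tfrac{\mathcal{D}(0)+\mathcal{R}(0)}{2}\,\tfrac{2\rho}{W(\tau)^{1/2}}+\tfrac{\mathcal{D}(0)-\mathcal{R}(0)}{2}\,\tfrac{4\rho^2}{W(\tau)},\qquad \mathcal{R}(\tau)=\tfrac{\mathcal{D}(0)+\mathcal{R}(0)}{2}\,\tfrac{2\rho}{W(\tau)^{1/2}}-\tfrac{\mathcal{D}(0)-\mathcal{R}(0)}{2}\,\tfrac{4\rho^2}{W(\tau)},$$ $$\mathcal{I}(\tau)=-\tfrac{\rho\,\Gamma\sinh(8p_3\rho\tau+\tau_0)}{W(\tau)},$$ where $$\tau_0=-(\operatorname{sign}\mathcal{I}(0))\cosh^{-1}\tfrac{4\rho^2-(\mathcal{D}(0)+\m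athcal{R}(0))^2}{\Gamma}=-\tanh^{-1}\tfrac{4\rho\,\mathcal{I}(0)}{4\rho^2-(\mathcal{D}(0)+\mathcal{R}(0))^2}.$$
   Context: $S^2_\rho=\{(x,y,z)\in\mathbb{R}^3: x^2+y^2+z^2=\rho^2\}$; the unknown $(\mathcal{D},\mathcal{R},\mathcal{I})$ is real valued with initial data in $S_\rho^2$, and the system preserves $S^2_\rho$. *)

theory Defs
  imports "HOL-Analysis.Analysis"
begin

definition S2 :: "real \<Rightarrow> (real \<times> real \<times> real) set" where
  "S2 \<rho> = {(x, y, z). x\<^sup>2 + y\<^sup>2 + z\<^sup>2 = \<rho>\<^sup>2}"

definition vfield :: "real \<Rightarrow> real \<Rightarrow> real \<times> real \<times> real \<Rightarrow> real \<times> real \<times> real" where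
  "vfield p1 p3 = (\<lambda>(D, R, I).
     (2 * I * (p1 * D - p3 * R),
      2 * I * (p1 * R - p3 * D),
      - 2 * p1 * (D\<^sup>2 + R\<^sup>2) + 4 * p3 * D * R))"

definition fixed_point :: "real \<Rightarrow> real \<Rightarrow> real \<times> real \<times> real \<Rightarrow> bool" where
  "fixed_point p1 p3 X \<longleftrightarrow> vfield p1 p3 X = 0"

text \<open>The derivative is taken within \<open>T\<close>, so it is one-sided at an endpoint belonging to \<open>T\<close>.\<close>

definition solution_on ::
    "real \<Rightarrow> real \<Rightarrow> real set \<Rightarrow> (real \<Rightarrow> real \<times> real \<times> real) \<Rightarrow> bool" where
  "solution_on p1 p3 T X \<longleftrightarrow>
     (\<forall>\<tau>\<in>T. (X has_vector_derivative vfield p1 p3 (X \<tau>)) (at \<tau> within T))"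

end

theory Submission
  imports Defs
begin

text \<open>The sum \<open>s\<close> and the difference \<open>d\<close> of the first two components decouple:
  \<open>s' = 4 p3 I s\<close>, \<open>d' = 8 p3 I d\<close> and \<open>I' = - 2 p3 s\<^sup>2 - 4 p3 d\<^sup>2\<close>, so \<open>s\<close> and \<open>d\<close> are
  constant multiples of \<open>W powr (-1/2)\<close> and \<open>1 / W\<close> when \<open>W\<close> satisfies \<open>W' = - 8 p3 I W\<close>.
  Uniqueness follows from a Gronwall estimate for the squared distance of two solutions; the
  cubic form that appears as its derivative is controlled by a bound on one of the solutions
  only, hence by the sphere on which the explicit solution lives.\<close>

section \<open>Gronwall estimates with zero initial value\<close>

text \<open>By \<open>bound\<close>, the product \<open>exp (- L * x) * g x\<close> has nonpositive
  derivative, so the mean value theorem keeps its value at \<open>b\<close> at most its value 0 at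
  \<open>a\<close>. The sign of \<open>g b\<close> then leaves only zero.\<close>

lemma gronwall_zero_forward:
  fixes g g' :: "real \<Rightarrow> real"
  assumes "a \<le> b" and "g a = 0" and "g b \<ge> 0"
    and deriv: "\<And>x. x \<in> {a..b} \<Longrightarrow> (g has_real_derivative g' x) (at x within {a..b})"
    and bound: "\<And>x. x \<in> {a..b} \<Longrightarrow> g' x \<le> L * g x"
  shows "g b = 0"
proof -
  let ?h = "\<lambda>x. exp (- L * x) * g x"
  have "(?h has_derivative (*) (exp (- L * x) * (g' x - L * g x))) (at x within {a..b})"
    if "a \<le> x" "x \<le> b" for x
    unfolding has_field_derivative_def [symmetric]
    using that by (auto intro!: derivative_eq_intros deriv simp: algebra_simps)
  from mvt_very_simple [OF \<open>a \<le> b\<close> this]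
  obtain x where x: "x \<in> {a..b}"
    and eq: "?h b - ?h a = exp (- L * x) * (g' x - L * g x) * (b - a)"
    by auto
  have "exp (- L * x) * (g' x - L * g x) * (b - a) \<le> 0"
    using bound [OF x] \<open>a \<le> b\<close> by (intro mult_nonpos_nonneg mult_nonneg_nonpos) auto
  with eq \<open>g a = 0\<close> have "exp (- L * b) * g b \<le> 0" by simp
  with \<open>g b \<ge> 0\<close> show ?thesis by (simp add: mult_le_0_iff)
qed

text \<open>Times before \<open>t0\<close> reduce to the forward case by the reflection of the time
  axis at 0. Reflection changes the sign of the derivative, which the two-sided bound on
  \<open>g'\<close> absorbs.\<close>

lemma gronwall_zero:
  fixes g g' :: "real \<Rightarrow> real"
  assumes T: "is_interval T" "t0 \<in> T" "t \<in> T"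
    and "g t0 = 0" and nonneg: "g t \<ge> 0"
    and deriv: "\<And>x. x \<in> T \<Longrightarrow> (g has_real_derivative g' x) (at x within T)"
    and bound: "\<And>x. x \<in> T \<Longrightarrow> \<bar>g' x\<bar> \<le> L * g x"
  shows "g t = 0"
proof (cases "t0 \<le> t")
  case True
  have sub: "{t0..t} \<subseteq> T"
    using mem_is_interval_1_I [OF T] by auto
  show ?thesis
  proof (rule gronwall_zero_forward [OF True \<open>g t0 = 0\<close> nonneg])
    fix x assume x: "x \<in> {t0..t}"
    with sub show "(g has_real_derivative g' x) (at x within {t0..t})"
      using DERIV_subset [OF deriv] by blast
    show "g' x \<le> L * g x" using bound [of x] sub x by auto
  qed
next
  case False
  have sub: "{t..t0} \<subseteq> T"
    using mem_is_interval_1_I [OF T(1,3,2)] by auto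
  let ?k = "\<lambda>x. g (- x)"
  have "?k (- t) = 0"
  proof (rule gronwall_zero_forward [where g = ?k and a = "- t0" and b = "- t" and g' = "\<lambda>x. - g' (- x)"])
    fix x assume x: "x \<in> {- t0..- t}"
    then have mem: "- x \<in> {t..t0}" by auto
    \<comment> \<open>\<open>DERIV_image_chain\<close> takes the derivative of the outer function
      within the image of the domain, so \<open>{t..t0}\<close> is written as a reflected
      interval.\<close>
    have "(g has_real_derivative g' (- x)) (at (- x) within uminus ` {- t0..- t})"
      using DERIV_subset [OF deriv sub] mem sub by auto
    then show "(?k has_real_derivative - g' (- x)) (at x within {- t0..- t})"
      using DERIV_image_chain [of g "g' (- x)" uminus x "{- t0..- t}" "-1"]
        DERIV_minus [OF DERIV_ident, of x "{- t0..- t}"]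
      by (simp add: o_def)
    show "- g' (- x) \<le> L * ?k x" using bound [of "- x"] sub mem by auto
  qed (use False assms in auto)
  then show ?thesis by simp
qed

section \<open>The system in components and its zeros\<close>

text \<open>Projections are bounded linear and pairing preserves derivatives. This opens the three
  coordinates to the rules for real derivatives.\<close>

lemma solution_on_iff_components:
  "solution_on p1 p3 T X \<longleftrightarrow> (\<forall>\<tau>\<in>T.
     ((\<lambda>t. fst (X t)) has_real_derivative fst (vfield p1 p3 (X \<tau>))) (at \<tau> within T) \<and>
     ((\<lambda>t. fst (snd (X t))) has_real_derivative fst (snd (vfield p1 p3 (X \<tau>)))) (at \<tau> within T) \<and>
     ((\<lambda>t. snd (snd (X t))) has_real_derivative snd (snd (vfield p1 p3 (X \<tau>)))) (at \<tau> within T))"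
proof -
  have "(X has_vector_derivative v) (at \<tau> within T) \<longleftrightarrow>
     ((\<lambda>t. fst (X t)) has_vector_derivative fst v) (at \<tau> within T) \<and>
     ((\<lambda>t. fst (snd (X t))) has_vector_derivative fst (snd v)) (at \<tau> within T) \<and>
     ((\<lambda>t. snd (snd (X t))) has_vector_derivative snd (snd v)) (at \<tau> within T)"
    (is "?L \<longleftrightarrow> ?R") for v \<tau>
  proof
    assume ?L
    then show ?R
      by (auto intro!: bounded_linear.has_vector_derivative
          [OF bounded_linear_fst] bounded_linear.has_vector_derivative [OF bounded_linear_snd])
  next
    assume ?R
    then have "((\<lambda>t. (fst (X t), fst (snd (X t)), snd (snd (X t)))) has_vector_derivative
      (fst v, fst (snd v), snd (snd v))) (at \<tau> within T)"
      by (intro has_vector_derivative_Pair) auto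
    then show ?L by simp
  qed
  then show ?thesis
    by (simp add: solution_on_def has_real_derivative_iff_has_vector_derivative)
qed

text \<open>For \<open>p1 = 3 * p3\<close> the last component of the field is minus
  \<open>p3\<close> times a positive definite quadratic form in \<open>D\<close> and
  \<open>R\<close>, so its vanishing already forces both to be 0.\<close>

lemma fixed_point_iff:
  assumes "p3 > 0"
  shows "fixed_point (3 * p3) p3 (D, R, I) \<longleftrightarrow> D = 0 \<and> R = 0"
proof
  assume "fixed_point (3 * p3) p3 (D, R, I)"
  then have "p3 * (2 * (D - R)\<^sup>2 + 4 * D\<^sup>2 + 4 * R\<^sup>2) = 0"
    by (simp add: fixed_point_def vfield_def prod_eq_iff power2_eq_square algebra_simps)
  with assms have "2 * (D - R)\<^sup>2 + 4 * D\<^sup>2 + 4 * R\<^sup>2 = 0" by simp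
  then show "D = 0 \<and> R = 0"
    using zero_le_power2 [of "D - R"] zero_le_power2 [of D] zero_le_power2 [of R]
    by (smt (verit) power2_eq_iff_nonneg zero_power2 zero_eq_power2)
qed (simp add: fixed_point_def vfield_def prod_eq_iff)

section \<open>Uniqueness of solutions\<close>

text \<open>The sphere is required of \<open>X\<close> alone, so a competitor \<open>Y\<close> is
  covered without first showing that it stays on the sphere.\<close>

lemma solution_unique:
  assumes "p3 > 0" and "\<rho> > 0"
    and T: "is_interval T" "t0 \<in> T" "\<tau> \<in> T"
    and X: "solution_on (3 * p3) p3 T X" "\<And>t. t \<in> T \<Longrightarrow> X t \<in> S2 \<rho>"
    and Y: "solution_on (3 * p3) p3 T Y" and "Y t0 = X t0"
  shows "Y \<tau> = X \<tau>"
proof -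
  let ?D = "\<lambda>Z t. fst (Z t)" and ?R = "\<lambda>Z t. fst (snd (Z t))" and ?I = "\<lambda>Z t. snd (snd (Z t))"
  define x where "x t = ?D Y t - ?D X t" for t
  define y where "y t = ?R Y t - ?R X t" for t
  define z where "z t = ?I Y t - ?I X t" for t
  define g where "g t = (x t)\<^sup>2 + (y t)\<^sup>2 + (z t)\<^sup>2" for t
  \<comment> \<open>The field is quadratic and orthogonal to the position vector, so in the
    derivative of \<open>g\<close> the terms cubic in the difference cancel. What remains is
    quadratic in the difference, with coefficients linear in \<open>X t\<close>.\<close>
  define g' where "g' t = 4 * p3 * (?I X t * ((x t + y t)\<^sup>2 + 2 * (x t - y t)\<^sup>2)
    - z t * ((x t + y t) * (?D X t + ?R X t) + 2 * (x t - y t) * (?D X t - ?R X t)))" for t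
  have "g \<tau> = 0"
  proof (rule gronwall_zero [OF T, where g' = g' and L = "32 * p3 * \<rho>"])
    show "g t0 = 0" using \<open>Y t0 = X t0\<close> by (simp add: g_def x_def y_def z_def)
    show "g \<tau> \<ge> 0" by (simp add: g_def)
    fix t assume t: "t \<in> T"
    note dX = X(1) [unfolded solution_on_iff_components, rule_format, OF t]
    note dY = Y [unfolded solution_on_iff_components, rule_format, OF t]
    show "(g has_real_derivative g' t) (at t within T)"
      unfolding g_def x_def y_def z_def g'_def
      by (rule derivative_eq_intros dX [THEN conjunct1] dX [THEN conjunct2, THEN conjunct1]
          dX [THEN conjunct2, THEN conjunct2] dY [THEN conjunct1]
          dY [THEN conjunct2, THEN conjunct1] dY [THEN conjunct2, THEN conjunct2] refl)+
        (simp add: vfield_def case_prod_unfold power2_eq_square algebra_simps)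
    obtain D R I where XE: "X t = (D, R, I)" by (cases "X t") auto
    have "D\<^sup>2 + R\<^sup>2 + I\<^sup>2 = \<rho>\<^sup>2" using X(2) [OF t] by (simp add: S2_def XE)
    then have "D\<^sup>2 \<le> \<rho>\<^sup>2" "R\<^sup>2 \<le> \<rho>\<^sup>2" "I\<^sup>2 \<le> \<rho>\<^sup>2"
      using zero_le_power2 [of D] zero_le_power2 [of R] zero_le_power2 [of I] by linarith+
    then have le: "\<bar>D\<bar> \<le> \<rho>" "\<bar>R\<bar> \<le> \<rho>" "\<bar>I\<bar> \<le> \<rho>"
      using \<open>\<rho> > 0\<close> by (auto simp: abs_le_square_iff [symmetric])
    define u v where "u = x t + y t" and "v = x t - y t"
    have "\<bar>I * (u\<^sup>2 + 2 * v\<^sup>2) - z t * (u * (D + R) + 2 * v * (D - R))\<bar>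
      \<le> \<bar>I\<bar> * (u\<^sup>2 + 2 * v\<^sup>2) + (\<bar>z t * u\<bar> * \<bar>D + R\<bar> + 2 * \<bar>z t * v\<bar> * \<bar>D - R\<bar>)"
    proof -
      have "z t * (u * (D + R) + 2 * v * (D - R)) = z t * u * (D + R) + 2 * (z t * v * (D - R))"
        by (simp add: algebra_simps)
      moreover have "\<bar>I * (u\<^sup>2 + 2 * v\<^sup>2)\<bar> = \<bar>I\<bar> * (u\<^sup>2 + 2 * v\<^sup>2)"
        by (simp add: abs_mult)
      moreover have "\<bar>p - (q + 2 * r)\<bar> \<le> \<bar>p\<bar> + (\<bar>q\<bar> + 2 * \<bar>r\<bar>)" for p q r :: real
        by linarith
      moreover have "\<bar>z t * u * (D + R)\<bar> = \<bar>z t * u\<bar> * \<bar>D + R\<bar>"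
        "\<bar>z t * v * (D - R)\<bar> = \<bar>z t * v\<bar> * \<bar>D - R\<bar>"
        by (simp_all add: abs_mult)
      ultimately show ?thesis by (metis mult.assoc)
    qed
    also have "\<dots> \<le> \<rho> * (u\<^sup>2 + 2 * v\<^sup>2) + (\<bar>z t * u\<bar> * (2 * \<rho>) + 2 * \<bar>z t * v\<bar> * (2 * \<rho>))"
      using le by (intro add_mono mult_mono) auto
    also have "\<dots> = \<rho> * (u\<^sup>2 + 2 * v\<^sup>2 + 2 * \<bar>z t * u\<bar> + 4 * \<bar>z t * v\<bar>)"
      by (simp add: algebra_simps)
    also have "\<dots> \<le> \<rho> * (8 * g t)"
    proof (rule mult_left_mono)
      \<comment> \<open>These bounds turn the left side into at most
        \<open>2 * u^2 + 4 * v^2 + 3 * (z t)^2\<close>. As \<open>u^2 + v^2\<close> is twice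
        \<open>(x t)^2 + (y t)^2\<close>, the constant becomes 8, and the factor
        \<open>4 * p3\<close> of \<open>g'\<close> makes it 32.\<close>
      have "2 * \<bar>z t * u\<bar> \<le> (z t)\<^sup>2 + u\<^sup>2" "2 * \<bar>z t * v\<bar> \<le> (z t)\<^sup>2 + v\<^sup>2"
        using sum_squares_bound [of "\<bar>z t\<bar>" "\<bar>u\<bar>"] sum_squares_bound [of "\<bar>z t\<bar>" "\<bar>v\<bar>"]
        by (simp_all add: abs_mult)
      moreover have "u\<^sup>2 + v\<^sup>2 = 2 * (x t)\<^sup>2 + 2 * (y t)\<^sup>2"
        by (simp add: u_def v_def power2_eq_square algebra_simps)
      ultimately show "u\<^sup>2 + 2 * v\<^sup>2 + 2 * \<bar>z t * u\<bar> + 4 * \<bar>z t * v\<bar> \<le> 8 * g t"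
        unfolding g_def distrib_left using zero_le_power2 [of u] zero_le_power2 [of "z t"]
        by linarith
    qed (use \<open>\<rho> > 0\<close> in simp)
    finally have "4 * p3 * \<bar>I * (u\<^sup>2 + 2 * v\<^sup>2) - z t * (u * (D + R) + 2 * v * (D - R))\<bar>
      \<le> 4 * p3 * (\<rho> * (8 * g t))"
      using \<open>p3 > 0\<close> by (intro mult_left_mono) auto
    then show "\<bar>g' t\<bar> \<le> 32 * p3 * \<rho> * g t"
      using \<open>p3 > 0\<close> by (simp add: g'_def XE u_def v_def abs_mult)
  qed
  then have "x \<tau> = 0" "y \<tau> = 0" "z \<tau> = 0"
    by (auto simp: g_def add_nonneg_eq_0_iff)
  then show ?thesis by (simp add: x_def y_def z_def prod_eq_iff)
qed

section \<open>The explicit family of solutions\<close>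

text \<open>Here \<open>a\<close> and \<open>b\<close> play the roles of the initial sum and
  difference, while the phase \<open>\<theta>\<close> stays free. The prescribed value of
  \<open>\<Gamma>\<close> squared is what makes the sphere equation and the equation for the third
  component reduce to the identity relating cosh and sinh.\<close>

lemma explicit_solution:
  fixes p3 \<rho> a b \<Gamma> \<theta> :: real
  assumes "\<Gamma> > 0" and \<Gamma>: "\<Gamma>\<^sup>2 = 8 * \<rho>\<^sup>2 * b\<^sup>2 + a ^ 4"
  defines "W \<equiv> \<lambda>\<tau>. \<Gamma> * cosh (8 * p3 * \<rho> * \<tau> + \<theta>) + a\<^sup>2"
  defines "X \<equiv> \<lambda>\<tau>. (a / 2 * (2 * \<rho> / sqrt (W \<tau>)) + b / 2 * (4 * \<rho>\<^sup>2 / W \<tau>),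
    a / 2 * (2 * \<rho> / sqrt (W \<tau>)) - b / 2 * (4 * \<rho>\<^sup>2 / W \<tau>),
    - (\<rho> * \<Gamma> * sinh (8 * p3 * \<rho> * \<tau> + \<theta>) / W \<tau>))"
  shows "W \<tau> > 0" and "X \<tau> \<in> S2 \<rho>" and "solution_on (3 * p3) p3 UNIV X"
proof -
  show W_pos: "W \<tau> > 0" for \<tau>
    unfolding W_def using \<open>\<Gamma> > 0\<close> by (intro add_pos_nonneg mult_pos_pos cosh_real_pos) auto
  define A where "A \<tau> = a * \<rho> / sqrt (W \<tau>)" for \<tau>
  define B where "B \<tau> = 2 * b * \<rho>\<^sup>2 / W \<tau>" for \<tau>
  define I where "I \<tau> = - (\<rho> * \<Gamma> * sinh (8 * p3 * \<rho> * \<tau> + \<theta>) / W \<tau>)" for \<tau>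
  have X_eq: "X = (\<lambda>\<tau>. (A \<tau> + B \<tau>, A \<tau> - B \<tau>, I \<tau>))"
    by (simp add: X_def A_def B_def I_def fun_eq_iff)
  have A2: "(A \<tau>)\<^sup>2 = a\<^sup>2 * \<rho>\<^sup>2 * W \<tau> / (W \<tau>)\<^sup>2" for \<tau>
    using W_pos [of \<tau>] by (simp add: A_def power_divide power_mult_distrib power2_eq_square)
  have B2: "(B \<tau>)\<^sup>2 = 4 * b\<^sup>2 * \<rho> ^ 4 / (W \<tau>)\<^sup>2" for \<tau>
    by (simp add: B_def power_divide power_mult_distrib)
  \<comment> \<open>Eliminating sinh in favour of \<open>W\<close> turns the sphere equation into a
    polynomial identity in \<open>W\<close>, \<open>a\<close>, \<open>b\<close> and
    \<open>\<rho>\<close>.\<close>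
  have sinh2: "(\<Gamma> * sinh (8 * p3 * \<rho> * \<tau> + \<theta>))\<^sup>2 = (W \<tau> - a\<^sup>2)\<^sup>2 - (8 * \<rho>\<^sup>2 * b\<^sup>2 + a ^ 4)" for \<tau>
  proof -
    have "(\<Gamma> * sinh (8 * p3 * \<rho> * \<tau> + \<theta>))\<^sup>2
      = (\<Gamma> * cosh (8 * p3 * \<rho> * \<tau> + \<theta>))\<^sup>2 - \<Gamma>\<^sup>2"
      by (simp add: power_mult_distrib sinh_square_eq right_diff_distrib)
    then show ?thesis by (simp add: W_def \<Gamma>)
  qed
  have I2: "(I \<tau>)\<^sup>2 = \<rho>\<^sup>2 * ((W \<tau> - a\<^sup>2)\<^sup>2 - (8 * \<rho>\<^sup>2 * b\<^sup>2 + a ^ 4)) / (W \<tau>)\<^sup>2" for \<tau>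
    by (simp add: I_def power_divide power_mult_distrib sinh2 [symmetric])
  have "(A \<tau> + B \<tau>)\<^sup>2 + (A \<tau> - B \<tau>)\<^sup>2 + (I \<tau>)\<^sup>2 = 2 * (A \<tau>)\<^sup>2 + 2 * (B \<tau>)\<^sup>2 + (I \<tau>)\<^sup>2"
    by (simp add: power2_eq_square algebra_simps)
  also have "\<dots> = (2 * (a\<^sup>2 * \<rho>\<^sup>2 * W \<tau>) + 2 * (4 * b\<^sup>2 * \<rho> ^ 4)
      + \<rho>\<^sup>2 * ((W \<tau> - a\<^sup>2)\<^sup>2 - (8 * \<rho>\<^sup>2 * b\<^sup>2 + a ^ 4))) / (W \<tau>)\<^sup>2"
    unfolding A2 B2 I2 by (simp add: add_divide_distrib)
  also have "2 * (a\<^sup>2 * \<rho>\<^sup>2 * W \<tau>) + 2 * (4 * b\<^sup>2 * \<rho> ^ 4)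
      + \<rho>\<^sup>2 * ((W \<tau> - a\<^sup>2)\<^sup>2 - (8 * \<rho>\<^sup>2 * b\<^sup>2 + a ^ 4)) = \<rho>\<^sup>2 * (W \<tau>)\<^sup>2"
    by (simp add: power2_eq_square power4_eq_xxxx algebra_simps)
  also have "\<dots> / (W \<tau>)\<^sup>2 = \<rho>\<^sup>2"
    using W_pos [of \<tau>] by simp
  finally show "X \<tau> \<in> S2 \<rho>" by (simp add: X_eq S2_def)

  have dW: "(W has_real_derivative 8 * p3 * \<rho> * (\<Gamma> * sinh (8 * p3 * \<rho> * \<tau> + \<theta>))) (at \<tau>)" for \<tau>
    unfolding W_def by (rule derivative_eq_intros refl)+ simp
  \<comment> \<open>The numerator of \<open>I\<close> is, up to the factor \<open>- 8 * p3\<close>,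
    the derivative of \<open>W\<close>: thus \<open>I\<close> is a multiple of the logarithmic
    derivative of \<open>W\<close>.\<close>
  then have dW': "(W has_real_derivative - 8 * p3 * I \<tau> * W \<tau>) (at \<tau>)" for \<tau>
    using W_pos [of \<tau>] by (simp add: I_def mult.assoc)
  have dsqrt: "((\<lambda>\<tau>. sqrt (W \<tau>)) has_real_derivative - 4 * p3 * I \<tau> * sqrt (W \<tau>)) (at \<tau>)" for \<tau>
  proof -
    have "W \<tau> = sqrt (W \<tau>) * sqrt (W \<tau>)"
      using W_pos [of \<tau>] by simp
    then have "- 8 * p3 * I \<tau> * W \<tau> * (inverse (sqrt (W \<tau>)) / 2) = - 4 * p3 * I \<tau> * sqrt (W \<tau>)"
      using W_pos [of \<tau>] by (simp add: divide_simps)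
    with DERIV_chain2 [OF DERIV_real_sqrt [OF W_pos] dW'] show ?thesis by (metis mult.commute)
  qed
  have dA: "(A has_real_derivative 4 * p3 * I \<tau> * A \<tau>) (at \<tau>)" for \<tau>
    unfolding A_def [abs_def] using W_pos [of \<tau>]
    by (intro DERIV_cong [OF DERIV_divide [OF DERIV_const dsqrt]]) (simp_all add: divide_simps)
  have dB: "(B has_real_derivative 8 * p3 * I \<tau> * B \<tau>) (at \<tau>)" for \<tau>
    using W_pos [of \<tau>] DERIV_divide [OF DERIV_const dW', of \<tau> "2 * b * \<rho>\<^sup>2"]
    by (simp add: B_def [abs_def] mult_ac)
  \<comment> \<open>Since \<open>A\<close> and \<open>B\<close> are half the sum and half the
    difference of the first two components, the coefficients 2 and 4 of the decoupled equation
    appear here multiplied by 4.\<close>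
  have dI: "(I has_real_derivative - 8 * p3 * (A \<tau>)\<^sup>2 - 16 * p3 * (B \<tau>)\<^sup>2) (at \<tau>)" for \<tau>
  proof -
    let ?C = "\<Gamma> * cosh (8 * p3 * \<rho> * \<tau> + \<theta>)" and ?S = "\<Gamma> * sinh (8 * p3 * \<rho> * \<tau> + \<theta>)"
    have "((\<lambda>\<tau>. - (\<rho> * \<Gamma> * sinh (8 * p3 * \<rho> * \<tau> + \<theta>))) has_real_derivative
        - (8 * p3 * \<rho>\<^sup>2 * ?C)) (at \<tau>)"
      by (rule derivative_eq_intros refl)+ (simp add: power2_eq_square)
    from DERIV_divide [OF this dW] W_pos [of \<tau>]
    have "(I has_real_derivative - 8 * p3 * \<rho>\<^sup>2 * (?C * W \<tau> - ?S\<^sup>2) / (W \<tau>)\<^sup>2) (at \<tau>)"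
      by (simp add: I_def [abs_def] power2_eq_square algebra_simps)
    \<comment> \<open>With \<open>?C = W \<tau> - a^2\<close> and \<open>sinh2\<close> the quadratic
      terms in \<open>W\<close> cancel, leaving one term for \<open>A\<close> squared and one for
      \<open>B\<close> squared.\<close>
    moreover have "?C * W \<tau> - ?S\<^sup>2 = a\<^sup>2 * W \<tau> + 8 * \<rho>\<^sup>2 * b\<^sup>2"
      unfolding sinh2 by (simp add: W_def power2_eq_square power4_eq_xxxx algebra_simps)
    moreover have "- 8 * p3 * \<rho>\<^sup>2 * (a\<^sup>2 * W \<tau> + 8 * \<rho>\<^sup>2 * b\<^sup>2) / (W \<tau>)\<^sup>2
        = - 8 * p3 * (A \<tau>)\<^sup>2 - 16 * p3 * (B \<tau>)\<^sup>2"
      unfolding A2 B2 divide_inverse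
      by (simp only: power2_eq_square power4_eq_xxxx) (simp only: algebra_simps)
    ultimately show ?thesis by metis
  qed
  have "((\<lambda>\<tau>. A \<tau> + B \<tau>) has_real_derivative
      2 * I \<tau> * (3 * p3 * (A \<tau> + B \<tau>) - p3 * (A \<tau> - B \<tau>))) (at \<tau>)"
    "((\<lambda>\<tau>. A \<tau> - B \<tau>) has_real_derivative
      2 * I \<tau> * (3 * p3 * (A \<tau> - B \<tau>) - p3 * (A \<tau> + B \<tau>))) (at \<tau>)"
    "(I has_real_derivative - 2 * (3 * p3) * ((A \<tau> + B \<tau>)\<^sup>2 + (A \<tau> - B \<tau>)\<^sup>2)
      + 4 * p3 * (A \<tau> + B \<tau>) * (A \<tau> - B \<tau>)) (at \<tau>)" for \<tau>
    by (rule DERIV_cong [OF DERIV_add [OF dA dB]] DERIV_cong [OF DERIV_diff [OF dA dB]]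
        DERIV_cong [OF dI]; simp add: power2_eq_square algebra_simps)+
  then show "solution_on (3 * p3) p3 UNIV X"
    by (simp add: solution_on_iff_components X_eq vfield_def)
qed

section \<open>Matching the phase to the initial point\<close>

text \<open>The claims on \<open>\<Gamma>\<close>, \<open>c\<close>, \<open>t\<close> and
  \<open>W\<close> place every quotient, root, \<open>arcosh\<close> and \<open>artanh\<close> in
  its genuine domain. That the formula gives the solution is read as existence for all times
  together with uniqueness on every interval containing 0.\<close>

theorem proposition2p20:
  fixes p1 p3 \<rho> :: real
  assumes "p3 > 0" and "p1 = 3 * p3" and "\<rho> > 0"
  shows "{X \<in> S2 \<rho>. fixed_point p1 p3 X} = {(0, 0, \<rho>), - (0, 0, \<rho>)} \<and>
    (\<forall>D0 R0 I0. (D0, R0, I0) \<in> S2 \<rho> \<and> \<not> fixed_point p1 p3 (D0, R0, I0) \<longrightarrow>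
      (let \<Gamma> = sqrt (8 * \<rho>\<^sup>2 * (D0 - R0)\<^sup>2 + (D0 + R0) ^ 4);
           c = (4 * \<rho>\<^sup>2 - (D0 + R0)\<^sup>2) / \<Gamma>;
           t = (4 * \<rho> * I0) / (4 * \<rho>\<^sup>2 - (D0 + R0)\<^sup>2);
           \<tau>0 = - sgn I0 * arcosh c;
           W = (\<lambda>\<tau>. \<Gamma> * cosh (8 * p3 * \<rho> * \<tau> + \<tau>0) + (D0 + R0)\<^sup>2);
           D = (\<lambda>\<tau>. (D0 + R0) / 2 * (2 * \<rho> / sqrt (W \<tau>)) + (D0 - R0) / 2 * (4 * \<rho>\<^sup>2 / W \<tau>));
           R = (\<lambda>\<tau>. (D0 + R0) / 2 * (2 * \<rho> / sqrt (W \<tau>)) - (D0 - R0) / 2 * (4 * \<rho>\<^sup>2 / W \<tau>));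
           I = (\<lambda>\<tau>. - (\<rho> * \<Gamma> * sinh (8 * p3 * \<rho> * \<tau> + \<tau>0) / W \<tau>));
           X = (\<lambda>\<tau>. (D \<tau>, R \<tau>, I \<tau>))
       in \<Gamma> > 0 \<and> c \<ge> 1 \<and> 4 * \<rho>\<^sup>2 - (D0 + R0)\<^sup>2 \<noteq> 0 \<and> \<bar>t\<bar> < 1 \<and> (\<forall>\<tau>. W \<tau> > 0) \<and>
          \<tau>0 = - artanh t \<and>
          X 0 = (D0, R0, I0) \<and> solution_on p1 p3 UNIV X \<and> (\<forall>\<tau>. X \<tau> \<in> S2 \<rho>) \<and>
          (\<forall>T Y. is_interval T \<and> 0 \<in> T \<and> solution_on p1 p3 T Y \<and> Y 0 = (D0, R0, I0) \<longrightarrow>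
             (\<forall>\<tau>\<in>T. Y \<tau> = X \<tau>))))"
proof (intro conjI allI impI, goal_cases)
  case 1
  show ?case
    using fixed_point_iff [OF \<open>p3 > 0\<close>] by (auto simp: \<open>p1 = 3 * p3\<close> S2_def power2_eq_iff)
next
  case (2 D0 R0 I0)
  note p1 = \<open>p1 = 3 * p3\<close>
  define a where "a = D0 + R0"
  define b where "b = D0 - R0"
  define \<Gamma> where "\<Gamma> = sqrt (8 * \<rho>\<^sup>2 * b\<^sup>2 + a ^ 4)"
  \<comment> \<open>This is the value that \<open>\<Gamma> * cosh \<tau>0\<close> must take for
    \<open>W 0 = 4 * \<rho>^2\<close>, which normalises both fractions in the formula to 1 at time
    0.\<close>
  define w where "w = 4 * \<rho>\<^sup>2 - a\<^sup>2"
  define \<tau>0 where "\<tau>0 = - sgn I0 * arcosh (w / \<Gamma>)"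
  define W where "W \<tau> = \<Gamma> * cosh (8 * p3 * \<rho> * \<tau> + \<tau>0) + a\<^sup>2" for \<tau>
  define X where "X \<tau> = (a / 2 * (2 * \<rho> / sqrt (W \<tau>)) + b / 2 * (4 * \<rho>\<^sup>2 / W \<tau>),
    a / 2 * (2 * \<rho> / sqrt (W \<tau>)) - b / 2 * (4 * \<rho>\<^sup>2 / W \<tau>),
    - (\<rho> * \<Gamma> * sinh (8 * p3 * \<rho> * \<tau> + \<tau>0) / W \<tau>))" for \<tau>

  have sphere: "D0\<^sup>2 + R0\<^sup>2 + I0\<^sup>2 = \<rho>\<^sup>2"
    using 2 by (simp add: S2_def)
  then have ab: "a\<^sup>2 + b\<^sup>2 + 2 * I0\<^sup>2 = 2 * \<rho>\<^sup>2"
    by (simp add: a_def b_def power2_eq_square algebra_simps)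
  have "a \<noteq> 0 \<or> b \<noteq> 0"
    using 2 fixed_point_iff [OF \<open>p3 > 0\<close>] by (auto simp: p1 a_def b_def)
  then have "8 * \<rho>\<^sup>2 * b\<^sup>2 + a ^ 4 > 0"
    using \<open>\<rho> > 0\<close> by (auto intro: add_pos_nonneg add_nonneg_pos)
  then have \<Gamma>: "\<Gamma> > 0" "\<Gamma>\<^sup>2 = 8 * \<rho>\<^sup>2 * b\<^sup>2 + a ^ 4"
    by (simp_all add: \<Gamma>_def)
  have "\<rho>\<^sup>2 > 0" using \<open>\<rho> > 0\<close> by simp
  then have w: "w > 0"
    unfolding w_def using ab zero_le_power2 [of b] zero_le_power2 [of I0] by linarith
  \<comment> \<open>In advance of the phase, this is the cosh and sinh identity for
    \<open>w = \<Gamma> * cosh \<tau>0\<close> and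
    \<open>4 * \<rho> * I0 = - \<Gamma> * sinh \<tau>0\<close>. It yields both
    \<open>c \<ge> 1\<close> and \<open>\<bar>t\<bar> < 1\<close>.\<close>
  have w2: "w\<^sup>2 = \<Gamma>\<^sup>2 + (4 * \<rho> * I0)\<^sup>2"
    unfolding w_def \<Gamma> using ab by algebra
  then have "\<Gamma> \<le> w"
    using w by (auto intro: power2_le_imp_le [of \<Gamma> w])
  then have c: "w / \<Gamma> \<ge> 1" using \<Gamma> by simp
  have "\<bar>4 * \<rho> * I0\<bar> < w"
    using w w2 \<Gamma>(1) by (intro power2_less_imp_less [of "\<bar>4 * \<rho> * I0\<bar>" w]) auto
  then have t: "\<bar>4 * \<rho> * I0 / w\<bar> < 1"
    using w by (simp add: abs_divide)
  have "\<Gamma> * sqrt ((w / \<Gamma>)\<^sup>2 - 1) = 4 * \<rho> * \<bar>I0\<bar>"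
  proof (rule power2_eq_imp_eq)
    show "(\<Gamma> * sqrt ((w / \<Gamma>)\<^sup>2 - 1))\<^sup>2 = (4 * \<rho> * \<bar>I0\<bar>)\<^sup>2"
      using c \<Gamma>(1) w2 by (simp add: power_mult_distrib power_divide right_diff_distrib)
  qed (use c \<Gamma>(1) \<open>\<rho> > 0\<close> in auto)
  \<comment> \<open>The root in \<open>sinh (arcosh c)\<close> only sees
    \<open>\<bar>I0\<bar>\<close>; the factor \<open>- sgn I0\<close> in the phase supplies the sign
    because sinh is odd.\<close>
  then have sinh: "\<Gamma> * sinh \<tau>0 = - (4 * \<rho> * I0)"
    using sinh_arcosh_real [OF c] by (cases I0 "0 :: real" rule: linorder_cases) (auto simp: \<tau>0_def)
  have cosh: "\<Gamma> * cosh \<tau>0 = w"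
  proof (cases "I0 = 0")
    case True
    \<comment> \<open>Here \<open>sgn 0 = 0\<close> gives \<open>\<tau>0 = 0\<close>, and
      \<open>w2\<close> gives \<open>w = \<Gamma>\<close>.\<close>
    with w2 w \<Gamma>(1) show ?thesis by (simp add: \<tau>0_def)
  next
    case False
    then have "cosh \<tau>0 = cosh (arcosh (w / \<Gamma>))"
      by (auto simp: \<tau>0_def sgn_if)
    with c \<Gamma>(1) show ?thesis by simp
  qed
  have "tanh \<tau>0 = (\<Gamma> * sinh \<tau>0) / (\<Gamma> * cosh \<tau>0)"
    using \<Gamma>(1) by (simp add: tanh_def)
  then have "4 * \<rho> * I0 / w = tanh (- \<tau>0)"
    by (simp add: sinh cosh)
  then have \<tau>0: "\<tau>0 = - artanh (4 * \<rho> * I0 / w)"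
    by (simp only: artanh_tanh_real minus_minus)
  note explicit = explicit_solution [OF \<Gamma>, where ?p3.0 = p3 and \<theta> = \<tau>0,
      folded W_def, folded X_def, folded X_def [abs_def]]
  have W0: "W 0 = 4 * \<rho>\<^sup>2" "sqrt (W 0) = 2 * \<rho>"
    using \<open>\<rho> > 0\<close> by (simp_all add: W_def cosh w_def real_sqrt_mult)
  have "X 0 = (D0, R0, I0)"
    unfolding X_def W0(2) unfolding W0(1) using \<open>\<rho> > 0\<close> sinh
    by (simp add: a_def b_def) (simp add: field_simps power2_eq_square)
  moreover have "Y \<tau> = X \<tau>"
    if "is_interval T" "0 \<in> T" "solution_on p1 p3 T Y" "Y 0 = (D0, R0, I0)" "\<tau> \<in> T" for T Y \<tau>
  proof (rule solution_unique [OF \<open>p3 > 0\<close> \<open>\<rho> > 0\<close>])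
    show "solution_on (3 * p3) p3 T X"
      using explicit(3) unfolding solution_on_def
      by (auto intro: has_vector_derivative_at_within)
  qed (use that explicit(2) \<open>X 0 = (D0, R0, I0)\<close> p1 in auto)
  ultimately show ?case
    using \<Gamma>(1) c w t \<tau>0 explicit unfolding Let_def p1
    unfolding a_def [symmetric] b_def [symmetric]
    unfolding \<Gamma>_def [symmetric] w_def [symmetric]
    unfolding \<tau>0_def [symmetric]
    unfolding W_def [symmetric]
    unfolding X_def [symmetric]
    by auto
qed

end
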